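(* Let $A,B\in\mathbb{R}$ with $-1\le B<A\le 1$, and let $f\in\mathcal{C}(A,B)$, $f(z)=z+\sum_{n\ge 2}a_nz^n$. Then $$\left|H_{2,1}\!\left(\frac{F_{f^{-1}}}{2}\right)\right|\le\begin{cases}\dfrac{(A-B)^2(11A^2-2AB-B^2)-48|5A-B|-4(5A-B)^2-112}{144\big((11A^2-2AB-B^2)-4|5A-B|-8\big)}, & |5A-B|\ge2,\\[3mm] \dfrac{(A-B)^2}{144}, & |5A-B|<2.\end{cases}$$ The last inequality (the one for $|5A-B|<2$) is sharp.
   Context: Let $\mathbb{D}=\{z\in\mathbb{C}:|z|<1\}$ and let $\mathcal{A}$ be the class of holomorphic functions $f$ on $\mathbb{D}$ with $f(0)=0$, $f'(0)=1$, i.e. $f(z)=z+\sum_{n=2}^\infty a_nz^n$. For holomorphic $g,h$ on $\mathbb{D}$, $g\prec h$ (subordination) means there is a holomorphic $\omega:\mathbb{D}\to\mathbb{D}$ with $\omega(0)=0$ and $g=h\circ\omega$. For $-1\le B<A\le1$, the Janowski convex class is $$\mathcal{C}(A,B)=\Big\{f\in\mathcal{A}: 1+\frac{zf''(z)}{f'(z)}\prec\frac{1+Az}{1+Bz}\Big\}.$$ Functions in $\mathcal{C}(A,B)$ are univalent. The logarithmic inverse coefficients $\Gamma_n$ of $f$ are defined by $F_{f^{-1}}(w)=\log\frac{f^{-1}(w)}{w}=2\sum_{n=1}^\infty\Gamma_nw^n$ for $|w|<1/4$; in particular $$\Gamma_1=-\tfrac12a_2,\quad \Gamma_2=-\tfrac12\big(a_3-\tfrac32a_2^2\big),\quad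 \Gamma_3=-\tfrac12\big(a_4-4a_2a_3+\tfrac{10}{3}a_2^3\big).$$ The second Hankel determinant of the logarithmic inverse coefficients is $$H_{2,1}\!\left(\frac{F_{f^{-1}}}{2}\right)=\Gamma_1\Gamma_3-\Gamma_2^2=\frac14\Big(\frac{13}{12}a_2^4+a_2a_4-a_2^2a_3-a_3^2\Big).$$ "Sharp" means that for each admissible $(A,B)$ with $|5A-B|<2$ there is a function $f\in\mathcal{C}(A,B)$ for which equality holds. *)

theory Defs
  imports "HOL-Complex_Analysis.Complex_Analysis"
begin

definition normalized_holomorphic :: "(complex \<Rightarrow> complex) set" where
  "normalized_holomorphic = {f. f holomorphic_on ball 0 1 \<and> f 0 = 0 \<and> deriv f 0 = 1}"

definition subordinate :: "(complex \<Rightarrow> complex) \<Rightarrow> (complex \<Rightarrow> complex) \<Rightarrow> bool" where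
  "subordinate g h \<longleftrightarrow>
     g holomorphic_on ball 0 1 \<and> h holomorphic_on ball 0 1 \<and>
     (\<exists>\<omega>. \<omega> holomorphic_on ball 0 1 \<and> \<omega> ` ball 0 1 \<subseteq> ball 0 1 \<and> \<omega> 0 = 0 \<and>
          (\<forall>z\<in>ball 0 1. g z = h (\<omega> z)))"

(* Since x / 0 = 0 here, the condition that the quotient z f'' / f' is defined on the whole disc
   is written out as non-vanishing of f'.  It excludes no function of the class: at a zero of f'
   other than 0 the quotient has a pole, so it could not be subordinate to a function that is
   holomorphic on the disc. *)
definition janowski_convex :: "real \<Rightarrow> real \<Rightarrow> (complex \<Rightarrow> complex) set" where
  "janowski_convex A B =
     {f \<in> normalized_holomorphic.
        (\<forall>z\<in>ball 0 1. deriv f z \<noteq> 0) \<and>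
        subordinate (\<lambda>z. 1 + z * deriv (deriv f) z / deriv f z)
                    (\<lambda>z. (1 + of_real A * z) / (1 + of_real B * z))}"

(* F(w) = log (f^{-1}(w) / w), where f^{-1} is the inverse of the univalent function f on the unit
   disc.  The singularity at w = 0 is removable, with value log 1 = 0.  Ln is the principal branch;
   f^{-1}(w) / w tends to 1 as w tends to 0, so near 0 it agrees with every continuous branch of
   the logarithm that vanishes at w = 0, and the coefficients below depend only on the germ at 0. *)
definition log_inverse :: "(complex \<Rightarrow> complex) \<Rightarrow> complex \<Rightarrow> complex" where
  "log_inverse f w = (if w = 0 then 0 else Ln (inv_into (ball 0 1) f w / w))"

(* Gamma_n, from log (f^{-1}(w) / w) = 2 * (\<Sum>n\<ge>1. Gamma_n * w^n) *)
definition log_inverse_coeff :: "(complex \<Rightarrow> complex) \<Rightarrow> nat \<Rightarrow> complex" where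
  "log_inverse_coeff f n = fps_nth (fps_expansion (log_inverse f) 0) n / 2"

(* The Hankel determinant H_{2,n} of a coefficient sequence c,
   i.e. the determinant of the 2 x 2 matrix with rows (c n, c (n+1)) and (c (n+1), c (n+2)) *)
definition hankel2 :: "(nat \<Rightarrow> complex) \<Rightarrow> nat \<Rightarrow> complex" where
  "hankel2 c n = c n * c (n + 2) - (c (n + 1))\<^sup>2"

end

theory Submission
  imports Defs
begin

text \<open>
  The idea is to express the Hankel determinant through the Schwarz function \<open>\<omega>\<close> with
  \<open>1 + z f'' / f' = (1 + A \<omega>) / (1 + B \<omega>)\<close>.  Comparison of coefficients gives \<open>a\<^sub>2\<close>, \<open>a\<^sub>3\<close>, \<open>a\<^sub>4\<close> in terms of
  the coefficients \<open>c\<^sub>1\<close>, \<open>c\<^sub>2\<close>, \<open>c\<^sub>3\<close> of \<open>\<omega>\<close>, and the determinant becomes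
  \<open>(A - B)\<^sup>2 / 576\<close> times
  \<open>T = 6 c\<^sub>1 c\<^sub>3 - N c\<^sub>1\<^sup>2 c\<^sub>2 + (M / 4) c\<^sub>1^4 - 4 c\<^sub>2\<^sup>2\<close>, where \<open>N = 5 A - B\<close> and
  \<open>M = 11 A\<^sup>2 - 2 A B - B\<^sup>2\<close> (lemma \<open>hankel2_janowski\<close>).

  By the Schwarz--Pick inequality, \<open>c\<^sub>2 = (1 - |c\<^sub>1|\<^sup>2) b\<close> and \<open>c\<^sub>3 = (1 - |c\<^sub>1|\<^sup>2) (d - cnj c\<^sub>1 b\<^sup>2)\<close> with
  \<open>|b| \<le> 1\<close> and \<open>|d| \<le> 1 - |b|\<^sup>2\<close> (lemma \<open>schwarz_function_coeffs\<close>).  With \<open>s = |c\<^sub>1|\<^sup>2\<close> the triangle inequality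
  then yields \<open>|T| \<le> (1 - s) (4 + 2 s + |N| s) + |M| s\<^sup>2 / 4\<close> (lemma \<open>schwarz_functional_bound\<close>).  If
  \<open>|N| < 2\<close>, this quadratic in \<open>s\<close> is at most its value 4 at \<open>s = 0\<close>, and \<open>\<omega> z = z\<^sup>2\<close> attains the
  bound.  If \<open>|N| \<ge> 2\<close>, its value at the vertex lies below the first bound of the theorem.

  One analytic point remains: \<open>inv_into (ball 0 1) f\<close> must agree near 0 with the holomorphic local
  inverse of \<open>f\<close>, although it may a priori select a preimage far from 0.  Functions of the class are
  convex, hence starlike (lemma \<open>convex_imp_Re_quotient_pos\<close>), so \<open>|f|\<close> increases along rays from 0, and
  small values of \<open>f\<close> are taken only near 0 (lemma \<open>inv_into_disc_germ\<close>).
\<close>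

section \<open>Coefficients of Schwarz functions\<close>

text \<open>This is the maximum principle: a value of modulus 1 in the disc is an interior maximum of
  \<open>|\<phi>|\<close>.\<close>

lemma bounded_by_one_dichotomy:
  assumes hol: "\<phi> holomorphic_on ball 0 1"
    and bd: "\<forall>z\<in>ball 0 1. norm (\<phi> z) \<le> 1"
  shows "(\<forall>z\<in>ball 0 1. norm (\<phi> z) < 1) \<or> (\<forall>z\<in>ball 0 1. \<phi> z = \<phi> 0)"
proof (rule disjCI)
  assume "\<not> (\<forall>z\<in>ball 0 1. \<phi> z = \<phi> 0)"
  then have nc: "\<not> \<phi> constant_on ball 0 1"
    by (metis constant_on_def centre_in_ball zero_less_one)
  show "\<forall>z\<in>ball 0 1. norm (\<phi> z) < 1"
  proof (rule ccontr)
    assume "\<not> (\<forall>z\<in>ball 0 1. norm (\<phi> z) < 1)"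
    then obtain \<xi> where "\<xi> \<in> ball 0 1" "norm (\<phi> \<xi>) \<ge> 1" by force
    then have "\<phi> constant_on ball 0 1"
      by (intro maximum_modulus_principle[OF hol, of "ball 0 1" \<xi>]) (use bd in force)+
    with nc show False ..
  qed
qed

lemma schwarz_quotient:
  assumes hol: "\<omega> holomorphic_on ball 0 1" and "\<omega> 0 = 0"
    and bd: "\<And>z. norm z < 1 \<Longrightarrow> norm (\<omega> z) < 1"
  obtains \<phi> where "\<phi> holomorphic_on ball 0 1" "\<And>z. z \<in> ball 0 1 \<Longrightarrow> \<omega> z = z * \<phi> z"
    "\<And>z. z \<in> ball 0 1 \<Longrightarrow> norm (\<phi> z) \<le> 1"
proof -
  obtain h where h: "h holomorphic_on ball 0 1" "\<And>z. norm z < 1 \<Longrightarrow> \<omega> z = z * h z"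
      "deriv \<omega> 0 = h 0"
    using Schwarz3[OF hol \<open>\<omega> 0 = 0\<close>] by metis
  have "norm (h z) \<le> 1" if "z \<in> ball 0 1" for z
  proof (cases "z = 0")
    case True
    then show ?thesis using Schwarz_Lemma(2)[OF hol \<open>\<omega> 0 = 0\<close> bd, of 0] h(3) by simp
  next
    case False
    have "norm (z * h z) \<le> norm z"
      using Schwarz_Lemma(1)[OF hol \<open>\<omega> 0 = 0\<close> bd, of z] h(2) that by simp
    with False show ?thesis by (simp add: norm_mult mult_le_cancel_left1)
  qed
  with h show ?thesis using that by auto
qed

text \<open>The function \<open>z \<theta>(z)\<close> is \<open>\<phi>\<close> followed by the disc automorphism that moves \<open>\<phi> 0\<close> to 0, so it
  vanishes at 0 and the Schwarz lemma bounds \<open>\<theta>\<close>.  The identity is cleared of denominators, so that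
  it can be compared coefficient by coefficient.\<close>

lemma schur_step:
  assumes hol: "\<phi> holomorphic_on ball 0 1"
    and bd: "\<And>z. z \<in> ball 0 1 \<Longrightarrow> norm (\<phi> z) < 1"
  obtains \<theta> where "\<theta> holomorphic_on ball 0 1"
    "\<And>z. z \<in> ball 0 1 \<Longrightarrow> \<phi> z - \<phi> 0 = z * \<theta> z * (1 - cnj (\<phi> 0) * \<phi> z)"
    "\<And>z. z \<in> ball 0 1 \<Longrightarrow> norm (\<theta> z) \<le> 1"
proof -
  define a where "a = \<phi> 0"
  have a: "norm a < 1" using bd[of 0] by (simp add: a_def)
  have nz: "1 - cnj a * \<phi> z \<noteq> 0" if "z \<in> ball 0 1" for z
  proof
    assume "1 - cnj a * \<phi> z = 0"
    then have "norm (cnj a * \<phi> z) = 1" by simp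
    moreover have "norm a * norm (\<phi> z) < 1 * 1"
      using a bd[OF that] by (intro mult_strict_mono') auto
    ultimately show False by (simp add: norm_mult)
  qed
  define \<psi> where "\<psi> = (\<lambda>z. (\<phi> z - a) / (1 - cnj a * \<phi> z))"
  have "\<psi> holomorphic_on ball 0 1"
    unfolding \<psi>_def using nz hol by (intro holomorphic_intros) auto
  moreover have "\<psi> 0 = 0" by (simp add: \<psi>_def a_def)
  moreover have "norm (\<psi> z) < 1" if "norm z < 1" for z
    using Moebius_function_norm_lt_1[of a "\<phi> z" 0] a bd[of z] that
    by (simp add: Moebius_function_simple \<psi>_def)
  ultimately obtain \<theta> where \<theta>: "\<theta> holomorphic_on ball 0 1"
      "\<And>z. z \<in> ball 0 1 \<Longrightarrow> \<psi> z = z * \<theta> z" "\<And>z. z \<in> ball 0 1 \<Longrightarrow> norm (\<theta> z) \<le> 1"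
    using schwarz_quotient by metis
  have "\<phi> z - \<phi> 0 = z * \<theta> z * (1 - cnj (\<phi> 0) * \<phi> z)" if "z \<in> ball 0 1" for z
    using \<theta>(2)[OF that] nz[OF that] by (auto simp: \<psi>_def a_def field_simps)
  with \<theta> show ?thesis using that by blast
qed

lemma fps_expansion_disc:
  assumes "f holomorphic_on ball 0 1"
  shows "f has_fps_expansion fps_expansion f 0"
  by (rule has_fps_expansion_fps_expansion[OF _ _ assms]) auto

lemma eventually_disc: "(\<And>z. z \<in> ball 0 1 \<Longrightarrow> P z) \<Longrightarrow> eventually P (nhds (0::complex))"
  using eventually_nhds_in_open[of "ball (0::complex) 1" 0]
  by (auto elim: eventually_mono)

lemma fps_expansion_unique_disc:
  assumes "f has_fps_expansion F" "g has_fps_expansion G"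
    "\<And>z. z \<in> ball 0 1 \<Longrightarrow> f z = (g z :: complex)"
  shows "F = G"
proof -
  have "g has_fps_expansion F"
    using assms(1) has_fps_expansion_cong[OF eventually_disc[of "\<lambda>z. f z = g z"] refl] assms(3)
    by blast
  then show ?thesis using assms(2) fps_expansion_unique_complex by blast
qed

text \<open>The first coefficients of \<open>\<phi>\<close> are polynomials in those of the function \<open>\<theta>\<close> that the Schur step
  returns.\<close>

lemma schur_step_coeffs:
  fixes a :: complex and P C :: "complex fps"
  assumes eq: "P - fps_const a = fps_X * C * (1 - fps_const (cnj a) * P)"
  shows "fps_nth P 0 = a"
    "fps_nth P 1 = (1 - (norm a)\<^sup>2) * fps_nth C 0"
    "fps_nth P 2 = (1 - (norm a)\<^sup>2) * (fps_nth C 1 - cnj a * (fps_nth C 0)\<^sup>2)"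
proof -
  have e: "fps_nth (P - fps_const a) n = fps_nth (fps_X * C * (1 - fps_const (cnj a) * P)) n" for n
    using eq by simp
  show P0: "fps_nth P 0 = a" using e[of 0] by simp
  have na: "complex_of_real ((norm a)\<^sup>2) = cnj a * a"
    by (subst complex_norm_square) (rule mult.commute)
  show P1: "fps_nth P 1 = (1 - (norm a)\<^sup>2) * fps_nth C 0"
    using e[of 1] P0 na by (simp add: fps_mult_nth mult.assoc algebra_simps)
  have "fps_nth P 2 = fps_nth C 1 * (1 - cnj a * a) - cnj a * fps_nth P 1 * fps_nth C 0"
    using e[of 2] P0 by (simp add: fps_mult_nth mult.assoc numeral_2_eq_2 algebra_simps)
  then show "fps_nth P 2 = (1 - (norm a)\<^sup>2) * (fps_nth C 1 - cnj a * (fps_nth C 0)\<^sup>2)"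
    unfolding P1 using na by (simp add: algebra_simps power2_eq_square)
qed

text \<open>A unimodular constant \<open>\<phi>\<close> has no disc automorphism attached to it, but the power series identity
  survives there with \<open>\<theta> = 0\<close>.  This makes the step available for every \<open>\<phi>\<close> of the closed unit ball.\<close>

lemma schur_step_fps:
  assumes hol: "\<phi> holomorphic_on ball 0 1"
    and bd: "\<forall>z\<in>ball 0 1. norm (\<phi> z) \<le> 1"
    and P: "\<phi> has_fps_expansion P"
  obtains \<theta> C where "\<theta> holomorphic_on ball 0 1" "\<forall>z\<in>ball 0 1. norm (\<theta> z) \<le> 1"
    "\<theta> has_fps_expansion C"
    "P - fps_const (\<phi> 0) = fps_X * C * (1 - fps_const (cnj (\<phi> 0)) * P)"
proof -
  have "(\<forall>z\<in>ball 0 1. norm (\<phi> z) < 1) \<or> (\<forall>z\<in>ball 0 1. \<phi> z = \<phi> 0)"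
    by (rule bounded_by_one_dichotomy[OF hol bd])
  then show ?thesis
  proof (elim disjE)
    assume "\<forall>z\<in>ball 0 1. norm (\<phi> z) < 1"
    then obtain \<theta> where \<theta>: "\<theta> holomorphic_on ball 0 1"
      "\<And>z. z \<in> ball 0 1 \<Longrightarrow> \<phi> z - \<phi> 0 = z * \<theta> z * (1 - cnj (\<phi> 0) * \<phi> z)"
      "\<forall>z\<in>ball 0 1. norm (\<theta> z) \<le> 1"
      using schur_step[OF hol] by metis
    define C where "C = fps_expansion \<theta> 0"
    have C: "\<theta> has_fps_expansion C" unfolding C_def by (rule fps_expansion_disc[OF \<theta>(1)])
    have eq: "P - fps_const (\<phi> 0) = fps_X * C * (1 - fps_const (cnj (\<phi> 0)) * P)"
      by (rule fps_expansion_unique_disc[where f = "\<lambda>z. \<phi> z - \<phi> 0", OF _ _ \<theta>(2)]) (intro fps_expansion_intros P C; simp)+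
    show ?thesis by (rule that[OF \<theta>(1,3) C eq])
  next
    assume c: "\<forall>z\<in>ball 0 1. \<phi> z = \<phi> 0"
    have "P = fps_const (\<phi> 0)"
      by (rule fps_expansion_unique_disc[OF P, where g = "\<lambda>_. \<phi> 0"])
        (simp, use c in blast)
    then show ?thesis
      by (intro that[of "\<lambda>_. 0" 0]) auto
  qed
qed

lemma schwarz_pick_coeff:
  assumes "\<phi> holomorphic_on ball 0 1" "\<forall>z\<in>ball 0 1. norm (\<phi> z) \<le> 1"
    and P: "\<phi> has_fps_expansion P"
  shows "norm (fps_nth P 0) \<le> 1" "norm (fps_nth P 1) \<le> 1 - (norm (fps_nth P 0))\<^sup>2"
proof -
  have P0: "fps_nth P 0 = \<phi> 0"
    using has_fps_expansion_imp_0_eq_fps_nth_0[OF P] by simp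
  show le1: "norm (fps_nth P 0) \<le> 1" using assms(2) P0 by (metis centre_in_ball zero_less_one)
  obtain \<theta> C where \<theta>: "\<theta> holomorphic_on ball 0 1" "\<forall>z\<in>ball 0 1. norm (\<theta> z) \<le> 1"
    and C: "\<theta> has_fps_expansion C"
    and eq: "P - fps_const (\<phi> 0) = fps_X * C * (1 - fps_const (cnj (\<phi> 0)) * P)"
    by (rule schur_step_fps[OF assms]) (rule that)
  have "norm (fps_nth C 0) \<le> 1"
    using \<theta>(2) has_fps_expansion_imp_0_eq_fps_nth_0[OF C] by (metis centre_in_ball zero_less_one)
  moreover have "fps_nth P 1 = of_real (1 - (norm (\<phi> 0))\<^sup>2) * fps_nth C 0"
    using schur_step_coeffs(2)[OF eq] by simp
  moreover have nn: "1 - (norm (\<phi> 0))\<^sup>2 \<ge> 0" using le1 P0 by (simp add: power_le_one)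
  ultimately show "norm (fps_nth P 1) \<le> 1 - (norm (fps_nth P 0))\<^sup>2"
    unfolding P0 by (simp only: norm_mult norm_of_real abs_of_nonneg[OF nn] mult_left_le[OF _ nn])
qed

text \<open>This is the part of the parametrisation of Schwarz functions that concerns the first three
  coefficients: \<open>\<omega> z / z\<close> is bounded by 1, one Schur step on it produces \<open>b\<close> and \<open>d\<close> as the first two
  coefficients of a function that is again bounded by 1, and the Schwarz--Pick inequality applies
  to these two.\<close>

lemma schwarz_function_coeffs:
  fixes \<omega> :: "complex \<Rightarrow> complex"
  assumes hol: "\<omega> holomorphic_on ball 0 1" and "\<omega> 0 = 0"
    and bd: "\<omega> ` ball 0 1 \<subseteq> ball 0 1"
    and W: "\<omega> has_fps_expansion W"
  obtains b d :: complex where "norm (fps_nth W 1) \<le> 1" "norm b \<le> 1" "norm d \<le> 1 - (norm b)\<^sup>2"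
    "fps_nth W 2 = (1 - (norm (fps_nth W 1))\<^sup>2) * b"
    "fps_nth W 3 = (1 - (norm (fps_nth W 1))\<^sup>2) * (d - cnj (fps_nth W 1) * b\<^sup>2)"
proof -
  obtain \<phi> where \<phi>: "\<phi> holomorphic_on ball 0 1" "\<And>z. z \<in> ball 0 1 \<Longrightarrow> \<omega> z = z * \<phi> z"
    "\<forall>z\<in>ball 0 1. norm (\<phi> z) \<le> 1"
  proof (rule schwarz_quotient[OF hol \<open>\<omega> 0 = 0\<close>])
    show "norm (\<omega> z) < 1" if "norm z < 1" for z
      using bd that by (force simp: image_subset_iff)
  qed (use that in blast)
  define P where "P = fps_expansion \<phi> 0"
  have P: "\<phi> has_fps_expansion P" unfolding P_def by (rule fps_expansion_disc[OF \<phi>(1)])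
  have "W = fps_X * P"
    by (rule fps_expansion_unique_disc[OF W _ \<phi>(2)]) (intro fps_expansion_intros P; simp)+
  then have nth: "fps_nth W 1 = fps_nth P 0" "fps_nth W 2 = fps_nth P 1" "fps_nth W 3 = fps_nth P 2"
    by simp_all
  have P0: "fps_nth P 0 = \<phi> 0"
    using has_fps_expansion_imp_0_eq_fps_nth_0[OF P] by simp
  obtain \<theta> C where \<theta>: "\<theta> holomorphic_on ball 0 1" "\<forall>z\<in>ball 0 1. norm (\<theta> z) \<le> 1"
    and C: "\<theta> has_fps_expansion C"
    and eq: "P - fps_const (\<phi> 0) = fps_X * C * (1 - fps_const (cnj (\<phi> 0)) * P)"
    by (rule schur_step_fps[OF \<phi>(1,3) P]) (rule that)
  show ?thesis
  proof (rule that)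
    show "norm (fps_nth W 1) \<le> 1"
      using schwarz_pick_coeff(1)[OF \<phi>(1,3) P] nth by simp
    show "norm (fps_nth C 0) \<le> 1" "norm (fps_nth C 1) \<le> 1 - (norm (fps_nth C 0))\<^sup>2"
      by (rule schwarz_pick_coeff[OF \<theta> C])+
    show "fps_nth W 2 = (1 - (norm (fps_nth W 1))\<^sup>2) * fps_nth C 0"
      "fps_nth W 3 = (1 - (norm (fps_nth W 1))\<^sup>2)
        * (fps_nth C 1 - cnj (fps_nth W 1) * (fps_nth C 0)\<^sup>2)"
      unfolding nth P0 by (rule schur_step_coeffs[OF eq])+
  qed
qed

section \<open>Convexity, starlikeness and the local inverse\<close>

text \<open>Convex functions are starlike.  The quotient \<open>p = f / (z f')\<close> satisfies
  \<open>z p' = 1 - p (1 + z f'' / f')\<close> and \<open>p 0 = 1\<close>.  Suppose that \<open>Re p\<close> is not positive everywhere, and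
  let \<open>z0\<close> be a point of smallest modulus with \<open>Re (p z0) \<le> 0\<close>.  Since \<open>Re p\<close> is positive inside the
  circle through \<open>z0\<close> and vanishes at \<open>z0\<close>, the number \<open>q = z0 p'(z0)\<close> is real and at most 0.  The
  imaginary part of the differential equation then forces \<open>p z0 = 0\<close>, and its real part gives the
  contradiction \<open>q = 1\<close>.\<close>

lemma convex_imp_Re_quotient_pos:
  assumes hol: "f holomorphic_on ball 0 1" and f0: "f 0 = 0"
    and nz: "\<And>z. z \<in> ball 0 1 \<Longrightarrow> deriv f z \<noteq> 0"
    and cvx: "\<And>z. z \<in> ball 0 1 \<Longrightarrow> Re (1 + z * deriv (deriv f) z / deriv f z) > 0"
    and z: "z \<in> ball 0 1" "z \<noteq> 0"
  shows "Re (f z / (z * deriv f z)) > 0"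
proof (rule ccontr)
  assume neg: "\<not> Re (f z / (z * deriv f z)) > 0"
  obtain h where h: "h holomorphic_on ball 0 1" "\<And>z. norm z < 1 \<Longrightarrow> f z = z * h z"
      "deriv f 0 = h 0"
    using Schwarz3[OF hol f0] by metis
  have hol': "deriv f holomorphic_on ball 0 1"
    using hol by (intro holomorphic_deriv) auto
  \<comment> \<open>Writing \<open>f = z h\<close> removes the singularity of \<open>f / (z f')\<close> at 0.\<close>
  define p where "p = (\<lambda>z. h z / deriv f z)"
  have holp: "p holomorphic_on ball 0 1"
    unfolding p_def using nz by (intro holomorphic_on_divide h(1) hol') auto
  have contp: "continuous_on (ball 0 1) p" by (rule holomorphic_on_imp_continuous_on[OF holp])
  have p0: "p 0 = 1" using h(3) nz[of 0] by (simp add: p_def)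
  have ode: "w * deriv p w = 1 - p w * (1 + w * deriv (deriv f) w / deriv f w)"
    if w: "w \<in> ball 0 1" for w
  proof -
    have dh: "(h has_field_derivative deriv h w) (at w)"
      using holomorphic_derivI[OF h(1) open_ball w] .
    have df': "(deriv f has_field_derivative deriv (deriv f) w) (at w)"
      using holomorphic_derivI[OF hol' open_ball w] .
    have "(p has_field_derivative
        (deriv h w * deriv f w - h w * deriv (deriv f) w) / (deriv f w * deriv f w)) (at w)"
      unfolding p_def by (rule DERIV_divide[OF dh df' nz[OF w]])
    then have dp: "deriv p w =
        (deriv h w * deriv f w - h w * deriv (deriv f) w) / (deriv f w * deriv f w)"
      by (rule DERIV_imp_deriv)
    have "((\<lambda>z. z * h z) has_field_derivative h w + w * deriv h w) (at w)"
      by (auto intro!: derivative_eq_intros dh)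
    then have "(f has_field_derivative h w + w * deriv h w) (at w)"
      by (rule has_field_derivative_transform_within_open[OF _ open_ball w]) (use h(2) in auto)
    then have "deriv f w = h w + w * deriv h w" by (rule DERIV_imp_deriv)
    then have wh: "w * deriv h w = deriv f w - h w" by simp
    have "w * deriv p w =
        (w * deriv h w * deriv f w - h w * (w * deriv (deriv f) w)) / (deriv f w * deriv f w)"
      unfolding dp by (simp add: algebra_simps)
    also have "\<dots> = 1 - p w * (1 + w * deriv (deriv f) w / deriv f w)"
      unfolding wh p_def using nz[OF w] by (simp add: field_simps)
    finally show ?thesis .
  qed
  have pz: "Re (p z) \<le> 0" using neg h(2)[of z] z by (simp add: p_def)
  define K where "K = {w \<in> cball 0 (norm z). Re (p w) \<le> 0}"
  have sub: "cball 0 (norm z) \<subseteq> ball (0::complex) 1" using z by auto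
  have "closed K"
    unfolding K_def
    by (intro continuous_on_closed_Collect_le continuous_intros
          continuous_on_subset[OF contp sub]) auto
  then have "compact K" 
    unfolding K_def by (metis (no_types, lifting) K_def bounded_cball bounded_subset compact_eq_bounded_closed mem_Collect_eq subsetI)
  moreover have "z \<in> K" using pz by (simp add: K_def)
  ultimately obtain z0 where z0: "z0 \<in> K" "\<And>w. w \<in> K \<Longrightarrow> norm z0 \<le> norm w"
    using continuous_attains_inf[of K norm] continuous_on_norm_id by blast
  have z0z: "norm z0 \<le> norm z" and pz0: "Re (p z0) \<le> 0" using z0(1) by (auto simp: K_def)
  have z0b: "z0 \<in> ball 0 1" using z0z z by simp
  have z0n: "z0 \<noteq> 0" using pz0 p0 by auto
  have pos: "Re (p w) > 0" if "norm w < norm z0" for w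
    using that z0(2)[of w] z0z by (force simp: K_def)
  have dp: "(p has_field_derivative deriv p z0) (at z0)"
    using holomorphic_derivI[OF holp open_ball z0b] .
  have Rep0: "Re (p z0) = 0"
  proof -
    have "z0 \<in> closure (ball 0 (norm z0))" using z0n by simp
    moreover have "continuous_on (closure (ball 0 (norm z0))) (\<lambda>w. Re (p w))"
      using z0n z0b by (intro continuous_intros continuous_on_subset[OF contp]) auto
    ultimately have "Re (p z0) \<ge> 0"
      using continuous_ge_on_closure[of "ball 0 (norm z0)" "\<lambda>w. Re (p w)" z0 0] pos
      by (force intro: less_imp_le)
    with pz0 show ?thesis by simp
  qed
  define q where "q = z0 * deriv p z0"
  \<comment> \<open>For \<open>Re v < 0\<close> the point \<open>z0 (1 + e v)\<close> lies inside the circle when \<open>e > 0\<close> is small, so \<open>Re p\<close>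
    cannot decrease from \<open>z0\<close> in the direction \<open>z0 v\<close>.\<close>
  have dir: "Re (q * v) \<ge> 0" if v: "Re v < 0" for v
  proof (rule ccontr)
    assume "\<not> Re (q * v) \<ge> 0"
    have "((\<lambda>e::real. z0 + of_real e * (z0 * v)) has_vector_derivative (z0 * v)) (at 0)"
      by (auto intro!: derivative_eq_intros)
    then have "(p \<circ> (\<lambda>e::real. z0 + of_real e * (z0 * v)) has_vector_derivative
        (z0 * v) * deriv p z0) (at 0)"
      by (rule field_vector_diff_chain_at) (use dp in simp)
    then have "((\<lambda>e::real. Re (p (z0 + of_real e * (z0 * v)))) has_vector_derivative
        Re ((z0 * v) * deriv p z0)) (at 0)"
      using bounded_linear.has_vector_derivative[OF bounded_linear_Re]
      by (simp add: o_def del: times_complex.sel)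
    then have "((\<lambda>e::real. Re (p (z0 + of_real e * (z0 * v)))) has_real_derivative
        Re (q * v)) (at 0)"
      by (simp add: has_real_derivative_iff_has_vector_derivative q_def mult_ac
          del: times_complex.sel)
    from DERIV_neg_dec_right[OF this] \<open>\<not> Re (q * v) \<ge> 0\<close> obtain d where d: "d > 0"
      "\<And>e. e > 0 \<Longrightarrow> e < d \<Longrightarrow> Re (p (z0 + of_real e * (z0 * v))) < Re (p z0)"
      by auto
    \<comment> \<open>With this \<open>e\<close>, \<open>|1 + e v|\<^sup>2 = 1 + 2 e Re v + e\<^sup>2 |v|\<^sup>2\<close> is at most \<open>1 + e Re v\<close>.\<close>
    define e where "e = min (d / 2) (- Re v / (norm v)\<^sup>2)"
    have nv: "(norm v)\<^sup>2 > 0" using v by auto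
    have e: "e > 0" "e < d" using d v nv by (auto simp: e_def divide_neg_pos)
    have "e \<le> - Re v / (norm v)\<^sup>2" by (simp add: e_def)
    then have "e * (norm v)\<^sup>2 \<le> - Re v" using nv by (simp only: pos_le_divide_eq)
    then have "e * (e * (norm v)\<^sup>2) \<le> e * (- Re v)" using e by (intro mult_left_mono) auto
    moreover have "(norm (1 + of_real e * v))\<^sup>2 = 1 + 2 * (e * Re v) + e * (e * (norm v)\<^sup>2)"
      unfolding cmod_power2 by (simp add: power2_eq_square algebra_simps)
    moreover have "e * Re v < 0" using e v by (simp add: mult_pos_neg)
    ultimately have "(norm (1 + of_real e * v))\<^sup>2 < 1" by simp
    then have "norm (1 + of_real e * v) < 1" using abs_square_less_1[of "norm (1 + of_real e * v)"] by simp
    then have "norm (z0 * (1 + of_real e * v)) < norm z0" using z0n by (simp add: norm_mult)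
    then have "Re (p (z0 * (1 + of_real e * v))) > 0" by (rule pos)
    moreover have "z0 * (1 + of_real e * v) = z0 + of_real e * (z0 * v)" by (simp add: algebra_simps)
    ultimately show False using d(2)[OF e] Rep0 by simp
  qed
  have Req: "Re q \<le> 0" using dir[of "-1"] by simp
  have Imq: "Im q = 0"
  proof (rule ccontr)
    assume "Im q \<noteq> 0"
    \<comment> \<open>The direction is chosen so that \<open>Re (q v) = -1\<close>.\<close>
    then show False using dir[of "Complex (-1) ((1 - Re q) / Im q)"] by (simp add: field_simps)
  qed
  define H where "H = 1 + z0 * deriv (deriv f) z0 / deriv f z0"
  have H: "Re H > 0" using cvx[OF z0b] by (simp add: H_def)
  have q: "q = 1 - p z0 * H" unfolding q_def H_def by (rule ode[OF z0b])
  then have "Im (p z0) * Re H = 0" using Imq Rep0 by simp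
  then have "Im (p z0) = 0" using H by simp
  then have "p z0 = 0" using Rep0 by (simp add: complex_eq_iff)
  with q Req show False by simp
qed

text \<open>The logarithmic derivative of \<open>|f|\<close> along a ray is \<open>Re (z f' / f) / |z|\<close>, and \<open>f / (z f')\<close> and its
  inverse have real parts of the same sign.\<close>

lemma starlike_norm_mono:
  assumes hol: "f holomorphic_on ball 0 1"
    and star: "\<And>z. z \<in> ball 0 1 \<Longrightarrow> z \<noteq> 0 \<Longrightarrow> Re (f z / (z * deriv f z)) > 0"
    and z: "z \<in> ball 0 1" and t: "0 < t" "t \<le> 1"
  shows "norm (f (of_real t * z)) \<le> norm (f z)"
proof (cases "z = 0")
  case False
  define g where "g = (\<lambda>s::real. (Re (f (of_real s * z)))\<^sup>2 + (Im (f (of_real s * z)))\<^sup>2)"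
  have "g t \<le> g 1"
  proof (rule DERIV_nonneg_imp_nondecreasing[OF t(2)])
    fix s assume s: "t \<le> s" "s \<le> 1"
    define w where "w = of_real s * z"
    have s0: "s > 0" using s t by simp
    have "norm w \<le> norm z" using s s0 by (simp add: w_def norm_mult mult_left_le_one_le)
    then have w: "w \<in> ball 0 1" using z by simp
    have w0: "w \<noteq> 0" using False s0 by (simp add: w_def)
    have df: "(f has_field_derivative deriv f w) (at w)"
      using holomorphic_derivI[OF hol open_ball w] .
    have "((\<lambda>s::real. of_real s * z) has_vector_derivative z) (at s)"
      by (auto intro!: derivative_eq_intros)
    then have v: "((\<lambda>s::real. f (of_real s * z)) has_vector_derivative z * deriv f w) (at s)"
      using field_vector_diff_chain_at[of "\<lambda>s::real. of_real s * z" z s f "deriv f w"] df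
      by (simp add: o_def w_def)
    have re: "((\<lambda>s::real. Re (f (of_real s * z))) has_real_derivative Re (z * deriv f w)) (at s)"
      using bounded_linear.has_vector_derivative[OF bounded_linear_Re v]
      by (simp add: has_real_derivative_iff_has_vector_derivative)
    have im: "((\<lambda>s::real. Im (f (of_real s * z))) has_real_derivative Im (z * deriv f w)) (at s)"
      using bounded_linear.has_vector_derivative[OF bounded_linear_Im v]
      by (simp add: has_real_derivative_iff_has_vector_derivative)
    define y where "y = 2 * (Re (f w) * Re (z * deriv f w) + Im (f w) * Im (z * deriv f w))"
    have "DERIV g s :> y"
      unfolding g_def y_def
      by (rule derivative_eq_intros re im refl | simp add: w_def)+
    moreover have "y \<ge> 0"
    proof -
      have cnj: "Re (a * cnj b) = Re a * Re b + Im a * Im b" for a b by simp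
      have "Re (f w) * Re (w * deriv f w) + Im (f w) * Im (w * deriv f w) > 0"
        using star[OF w w0] unfolding Re_complex_div_gt_0 cnj .
      then have "0 < 2 * (Re (f w) * Re (w * deriv f w) + Im (f w) * Im (w * deriv f w))"
        by (rule mult_pos_pos[OF zero_less_numeral])
      also have "\<dots> = s * y"
        by (simp add: w_def y_def algebra_simps)
      finally have "s * y > 0" .
      with s0 show ?thesis by (simp add: zero_less_mult_iff)
    qed
    ultimately show "\<exists>y. DERIV g s :> y \<and> 0 \<le> y" by blast
  qed
  then have "(norm (f (of_real t * z)))\<^sup>2 \<le> (norm (f z))\<^sup>2"
    by (simp add: g_def cmod_power2)
  then show ?thesis by (rule power2_le_imp_le) simp
qed simp

text \<open>The function \<open>inv_into (ball 0 1) f\<close> picks any preimage in the disc.  Near 0 there is only one to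
  pick: by monotonicity of \<open>|f|\<close> along rays, a preimage of a small value cannot lie away from 0, and
  near 0 the function \<open>f\<close> is injective with a holomorphic inverse.\<close>

lemma inv_into_disc_germ:
  assumes hol: "f holomorphic_on ball 0 1" and f0: "f 0 = 0" and d0: "deriv f 0 \<noteq> 0"
    and nz: "\<And>z. z \<in> ball 0 1 \<Longrightarrow> z \<noteq> 0 \<Longrightarrow> f z \<noteq> 0"
    and mono: "\<And>z t. z \<in> ball 0 1 \<Longrightarrow> 0 < t \<Longrightarrow> t \<le> 1 \<Longrightarrow> norm (f (of_real t * z)) \<le> norm (f z)"
  obtains g where "g analytic_on {0}" "g 0 = 0" "\<forall>\<^sub>F w in nhds 0. f (g w) = w"
    "\<forall>\<^sub>F w in nhds 0. inv_into (ball 0 1) f w = g w"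
proof -
  obtain r where r: "r > 0" "ball 0 r \<subseteq> ball (0::complex) 1" "inj_on f (ball 0 r)"
    using has_complex_derivative_locally_injective[OF hol _ open_ball d0] by auto
  have holr: "f holomorphic_on ball 0 r" using hol r(2) holomorphic_on_subset by blast
  obtain g where g: "g holomorphic_on f ` ball 0 r" "\<And>z. z \<in> ball 0 r \<Longrightarrow> g (f z) = z"
    using holomorphic_has_inverse[OF holr open_ball r(3)] by metis
  have opn: "open (f ` ball 0 r)" by (rule open_mapping_thm3[OF holr open_ball r(3)])
  have in0: "0 \<in> f ` ball 0 r" using f0 r(1) by (metis centre_in_ball image_eqI)
  have r1: "r \<le> 1"
  proof (rule ccontr)
    assume "\<not> r \<le> 1"
    then have "1 \<in> ball (0::complex) r" by simp
    with r(2) have "1 \<in> ball (0::complex) 1" by (rule subsetD)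
    then show False by simp
  qed
  have "compact (sphere (0::complex) (r/2))" "sphere (0::complex) (r/2) \<noteq> {}" using r(1) by auto
  moreover have "continuous_on (sphere 0 (r/2)) (\<lambda>z. norm (f z))"
    using r1 r(1) by (intro continuous_intros continuous_on_subset[OF holomorphic_on_imp_continuous_on[OF hol]]) auto
  ultimately obtain \<xi> where \<xi>: "\<xi> \<in> sphere 0 (r/2)"
      "\<And>z. z \<in> sphere 0 (r/2) \<Longrightarrow> norm (f \<xi>) \<le> norm (f z)"
    using continuous_attains_inf[of "sphere 0 (r/2)" "\<lambda>z. norm (f z)"] by metis
  have \<xi>0: "f \<xi> \<noteq> 0" using \<xi>(1) r r1 by (intro nz) auto
  have small: "z \<in> ball 0 r" if z: "z \<in> ball 0 1" "norm (f z) < norm (f \<xi>)" for z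
  proof (rule ccontr)
    assume "z \<notin> ball 0 r"
    then have zr: "norm z \<ge> r" by simp
    \<comment> \<open>The factor \<open>t\<close> pulls \<open>z\<close> back along its ray to the circle on which \<open>\<xi>\<close> minimises \<open>|f|\<close>.\<close>
    define t where "t = r / 2 / norm z"
    have "norm z > 0" using zr r(1) by linarith
    have t: "0 < t" "t \<le> 1"
      using zr r(1) \<open>norm z > 0\<close> by (auto simp: t_def divide_simps)
    have "norm (of_real t * z) = t * norm z" using t(1) by (simp add: norm_mult)
    also have "\<dots> = r / 2" using \<open>norm z > 0\<close> by (simp add: t_def)
    finally have "norm (of_real t * z) = r / 2" .
    then have "norm (f \<xi>) \<le> norm (f (of_real t * z))" by (intro \<xi>(2)) simp
    also have "\<dots> \<le> norm (f z)" by (rule mono[OF z(1) t])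
    finally show False using z(2) by simp
  qed
  have ev1: "\<forall>\<^sub>F w in nhds 0. w \<in> f ` ball 0 r"
    by (rule eventually_nhds_in_open[OF opn in0])
  have ev2: "\<forall>\<^sub>F w in nhds 0. w \<in> ball 0 (norm (f \<xi>))"
    using \<xi>0 by (intro eventually_nhds_in_open) auto
  show ?thesis
  proof (rule that[of g])
    show "g analytic_on {0}" using g(1) opn in0 analytic_at by blast
    show "g 0 = 0" using g(2)[of 0] f0 r(1) by simp
    show "\<forall>\<^sub>F w in nhds 0. f (g w) = w" using ev1 by eventually_elim (use g(2) in auto)
    show "\<forall>\<^sub>F w in nhds 0. inv_into (ball 0 1) f w = g w"
      using ev1 ev2
    proof eventually_elim
      case (elim w)
      then have w: "w \<in> f ` ball 0 1" using r(2) by blast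
      define u where "u = inv_into (ball 0 1) f w"
      have u: "u \<in> ball 0 1" "f u = w" using inv_into_into[OF w] f_inv_into_f[OF w] by (auto simp: u_def)
      have "u \<in> ball 0 r" using small[OF u(1)] u(2) elim(2) by simp
      then have "g w = u" using g(2)[of u] u(2) by simp
      then show ?case by (simp add: u_def)
    qed
  qed
qed

section \<open>Power series of the inverse, its logarithm and the Janowski equation\<close>

lemma fps_inverse_coeffs:
  fixes F G :: "complex fps"
  assumes F: "fps_nth F 0 = 0" "fps_nth F 1 = 1" and G: "fps_nth G 0 = 0"
    and eq: "fps_compose F G = fps_X"
  shows "fps_nth G 1 = 1" "fps_nth G 2 = - fps_nth F 2"
    "fps_nth G 3 = 2 * (fps_nth F 2)\<^sup>2 - fps_nth F 3"
    "fps_nth G 4 = 5 * fps_nth F 2 * fps_nth F 3 - 5 * fps_nth F 2 ^ 3 - fps_nth F 4"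
proof -
  have e: "fps_nth (fps_compose F G) n = fps_nth fps_X n" for n using eq by simp
  show 1: "fps_nth G 1 = 1"
    using e[of 1] F G by (simp add: fps_compose_nth)
  have "fps_nth G 2 + fps_nth F 2 = 0"
    using e[of 2] F G 1 by (simp add: fps_compose_nth fps_mult_nth eval_nat_numeral)
  then show 2: "fps_nth G 2 = - fps_nth F 2" by (simp add: eq_neg_iff_add_eq_0)
  have "fps_nth G 3 + fps_nth F 2 * (2 * fps_nth G 2) + fps_nth F 3 = 0"
    using e[of 3] F G 1 by (simp add: fps_compose_nth fps_mult_nth eval_nat_numeral)
  then show 3: "fps_nth G 3 = 2 * (fps_nth F 2)\<^sup>2 - fps_nth F 3"
    unfolding 2 by (simp add: algebra_simps power2_eq_square add_eq_0_iff)
  have "fps_nth G 4 + fps_nth F 2 * (2 * fps_nth G 3 + (fps_nth G 2)\<^sup>2)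
      + fps_nth F 3 * (3 * fps_nth G 2) + fps_nth F 4 = 0"
    using e[of 4] F G 1 by (simp add: fps_compose_nth fps_mult_nth eval_nat_numeral algebra_simps)
  then show "fps_nth G 4 = 5 * fps_nth F 2 * fps_nth F 3 - 5 * fps_nth F 2 ^ 3 - fps_nth F 4"
    unfolding 2 3 by algebra
qed

text \<open>Comparison of coefficients in \<open>U' = U L'\<close>, that is, the expansion of \<open>log U\<close>.\<close>

lemma fps_log_coeffs:
  fixes U L :: "complex fps"
  assumes U0: "fps_nth U 0 = 1" and eq: "fps_deriv U = U * fps_deriv L"
  shows "fps_nth L 1 = fps_nth U 1" "fps_nth L 2 = fps_nth U 2 - (fps_nth U 1)\<^sup>2 / 2"
    "fps_nth L 3 = fps_nth U 3 - fps_nth U 1 * fps_nth U 2 + fps_nth U 1 ^ 3 / 3"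
proof -
  have e: "fps_nth (fps_deriv U) n = fps_nth (U * fps_deriv L) n" for n using eq by simp
  show 1: "fps_nth L 1 = fps_nth U 1" using e[of 0] U0 by simp
  have e2: "2 * fps_nth U 2 = 2 * fps_nth L 2 + fps_nth U 1 * fps_nth L 1"
    using e[of 1] U0 by (simp add: fps_mult_nth eval_nat_numeral)
  then show 2: "fps_nth L 2 = fps_nth U 2 - (fps_nth U 1)\<^sup>2 / 2"
    unfolding 1 by (simp add: field_simps power2_eq_square)
  have "3 * fps_nth U 3 = 3 * fps_nth L 3 + fps_nth U 1 * (2 * fps_nth L 2) + fps_nth U 2 * fps_nth L 1"
    using e[of 2] U0 by (simp add: fps_mult_nth eval_nat_numeral)
  then have "3 * fps_nth L 3 = 3 * fps_nth U 3 - 3 * fps_nth U 1 * fps_nth U 2 + fps_nth U 1 ^ 3"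
    using e2 1 by algebra
  then show "fps_nth L 3 = fps_nth U 3 - fps_nth U 1 * fps_nth U 2 + fps_nth U 1 ^ 3 / 3"
    by (simp add: field_simps)
qed

text \<open>Write \<open>G\<close> for the series of the inverse and \<open>U = G / X\<close>.  The series \<open>L\<close> of \<open>log_inverse f\<close> satisfies
  \<open>exp L = U\<close>; it is recorded through its derivative \<open>U' = U L'\<close>, which is linear in \<open>L\<close>.\<close>

lemma log_inverse_germ_fps:
  assumes F: "f has_fps_expansion F" "fps_nth F 0 = 0" "fps_nth F 1 = 1"
    and g: "g analytic_on {0}" "g 0 = 0" "\<forall>\<^sub>F w in nhds 0. f (g w) = w"
    and inv: "\<forall>\<^sub>F w in nhds 0. inv_into (ball 0 1) f w = g w"
  obtains G L where "fps_nth G 0 = 0" "fps_compose F G = fps_X"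
    "fps_deriv (fps_shift 1 G) = fps_shift 1 G * fps_deriv L"
    "log_inverse f has_fps_expansion L"
proof -
  define G where "G = fps_expansion g 0"
  have G: "g has_fps_expansion G"
    unfolding G_def by (rule analytic_at_imp_has_fps_expansion_0[OF g(1)])
  have G0: "fps_nth G 0 = 0"
    using has_fps_expansion_imp_0_eq_fps_nth_0[OF G] g(2) by simp
  have "(f \<circ> g) has_fps_expansion fps_compose F G"
    by (rule has_fps_expansion_compose[OF F(1) G G0])
  moreover have "(f \<circ> g) has_fps_expansion fps_X"
    using has_fps_expansion_cong[of "f \<circ> g" "\<lambda>w. w" fps_X fps_X] g(3) has_fps_expansion_fps_X
    by (simp add: o_def)
  ultimately have FG: "fps_compose F G = fps_X"
    using fps_expansion_unique_complex by blast
  have G1: "fps_nth G 1 = 1"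
    by (rule fps_inverse_coeffs(1)[OF F(2,3) G0 FG])
  define u where "u = (\<lambda>w. if w = 0 then 1 else g w / w)"
  have u: "u has_fps_expansion fps_shift 1 G"
    unfolding u_def
  proof -
    have "1 \<le> subdegree G" using G0 G1 by (intro subdegree_geI) auto
    then show "(\<lambda>w. if w = 0 then 1 else g w / w) has_fps_expansion fps_shift 1 G"
      using has_fps_expansion_shift[OF G, of 1 1] G1 unfolding power_one_right by simp
  qed
  have u0: "u 0 = 1" by (simp add: u_def)
  have anu: "u analytic_on {0}" using has_fps_expansion_imp_analytic_0[OF u] .
  define \<l> where "\<l> = (\<lambda>w. Ln (u w))"
  have "\<l> analytic_on {0}"
    unfolding \<l>_def using anu u0 by (intro analytic_intros) auto
  then have L: "\<l> has_fps_expansion fps_expansion \<l> 0" (is "_ has_fps_expansion ?L")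
    by (rule analytic_at_imp_has_fps_expansion_0)
  have L0: "fps_nth ?L 0 = 0"
    using has_fps_expansion_imp_0_eq_fps_nth_0[OF L] u0 by (simp add: \<l>_def)
  have "isCont u 0" using has_fps_expansion_imp_continuous[OF u] by simp
  then have "(u \<longlongrightarrow> u 0) (nhds 0)"
    unfolding isCont_def tendsto_at_iff_tendsto_nhds .
  then have "\<forall>\<^sub>F w in nhds 0. u w \<noteq> 0"
    by (rule tendsto_imp_eventually_ne) (simp add: u0)
  then have "\<forall>\<^sub>F w in nhds 0. (exp \<circ> \<l>) w = u w"
    by eventually_elim (simp add: \<l>_def)
  moreover have "(exp \<circ> \<l>) has_fps_expansion fps_compose (fps_exp 1) ?L"
    by (rule has_fps_expansion_compose[OF has_fps_expansion_exp1 L L0])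
  ultimately have "u has_fps_expansion fps_compose (fps_exp 1) ?L"
    using has_fps_expansion_cong by blast
  then have U: "fps_shift 1 G = fps_compose (fps_exp 1) ?L"
    using u fps_expansion_unique_complex by blast
  have "fps_deriv (fps_shift 1 G) = fps_shift 1 G * fps_deriv ?L"
    unfolding U by (subst fps_compose_deriv[OF L0]) simp
  moreover have "\<forall>\<^sub>F w in nhds 0. log_inverse f w = \<l> w"
    using inv by eventually_elim (simp add: log_inverse_def \<l>_def u_def)
  then have "log_inverse f has_fps_expansion ?L"
    using has_fps_expansion_cong L by blast
  ultimately show ?thesis using that G0 FG by blast
qed

lemma hankel2_log_inverse:
  assumes F: "f has_fps_expansion F" "fps_nth F 0 = 0" "fps_nth F 1 = 1"
    and g: "g analytic_on {0}" "g 0 = 0" "\<forall>\<^sub>F w in nhds 0. f (g w) = w"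
    and inv: "\<forall>\<^sub>F w in nhds 0. inv_into (ball 0 1) f w = g w"
  shows "hankel2 (log_inverse_coeff f) 1 =
    (13 / 12 * fps_nth F 2 ^ 4 + fps_nth F 2 * fps_nth F 4 - (fps_nth F 2)\<^sup>2 * fps_nth F 3
      - (fps_nth F 3)\<^sup>2) / 4"
proof -
  obtain G L where G: "fps_nth G 0 = 0" "fps_compose F G = fps_X"
    and L: "fps_deriv (fps_shift 1 G) = fps_shift 1 G * fps_deriv L"
    and LL: "log_inverse f has_fps_expansion L"
    using log_inverse_germ_fps[OF F g inv] by metis
  note Gc = fps_inverse_coeffs[OF F(2,3) G]
  have U0: "fps_nth (fps_shift 1 G) 0 = 1" using Gc(1) by simp
  note Lc = fps_log_coeffs[OF U0 L]
  have sh: "fps_nth (fps_shift 1 G) 1 = fps_nth G 2" "fps_nth (fps_shift 1 G) 2 = fps_nth G 3"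
    "fps_nth (fps_shift 1 G) 3 = fps_nth G 4" by (simp_all add: eval_nat_numeral)
  have coeff: "log_inverse_coeff f n = fps_nth L n / 2" for n
    by (simp add: log_inverse_coeff_def fps_expansion_eqI[OF LL])
  have H: "hankel2 (log_inverse_coeff f) 1 = (fps_nth L 1 * fps_nth L 3 - (fps_nth L 2)\<^sup>2) / 4"
    by (simp add: hankel2_def coeff eval_nat_numeral power2_eq_square field_simps)
  show ?thesis
    unfolding H Lc sh Gc
    by (simp add: field_simps power2_eq_square power3_eq_cube power4_eq_xxxx)
qed

text \<open>The differential equation is the defining relation
  \<open>z f'' / f' = (1 + A \<omega>) / (1 + B \<omega>) - 1\<close> of the class, multiplied out.  It determines the
  coefficients of \<open>f\<close> recursively from those of \<open>\<omega>\<close>.\<close>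

lemma janowski_fps_coeffs:
  fixes F W :: "complex fps" and A B :: complex
  assumes F1: "fps_nth F 1 = 1" and W0: "fps_nth W 0 = 0"
    and ode: "fps_X * fps_deriv (fps_deriv F) * (1 + fps_const B * W) = fps_const (A - B) * W * fps_deriv F"
  shows "fps_nth F 2 = (A - B) * fps_nth W 1 / 2"
    "fps_nth F 3 = (A - B) * (fps_nth W 2 + (A - 2 * B) * (fps_nth W 1)\<^sup>2) / 6"
    "fps_nth F 4 = (A - B) * (2 * fps_nth W 3 + (3 * A - 7 * B) * fps_nth W 1 * fps_nth W 2
       + (A - 2 * B) * (A - 3 * B) * fps_nth W 1 ^ 3) / 24"
proof -
  have e: "fps_nth (fps_X * (fps_deriv (fps_deriv F) * (1 + fps_const B * W))) n
      = fps_nth (fps_const (A - B) * (W * fps_deriv F)) n" for n using ode by (simp add: mult.assoc)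
  have e2: "2 * fps_nth F 2 = (A - B) * fps_nth W 1"
    using e[of 1] F1 W0 by (simp add: fps_mult_nth eval_nat_numeral)
  then show "fps_nth F 2 = (A - B) * fps_nth W 1 / 2" by (simp add: field_simps)
  have "2 * fps_nth F 2 * (B * fps_nth W 1) + 6 * fps_nth F 3
      = (A - B) * (fps_nth W 1 * (2 * fps_nth F 2) + fps_nth W 2)"
    using e[of 2] F1 W0 by (simp add: fps_mult_nth eval_nat_numeral)
  then have e3: "6 * fps_nth F 3 = (A - B) * (fps_nth W 2 + (A - 2 * B) * (fps_nth W 1)\<^sup>2)"
    using e2 by algebra
  then show "fps_nth F 3 = (A - B) * (fps_nth W 2 + (A - 2 * B) * (fps_nth W 1)\<^sup>2) / 6" by (simp add: field_simps)
  have "2 * fps_nth F 2 * (B * fps_nth W 2) + 6 * fps_nth F 3 * (B * fps_nth W 1) + 12 * fps_nth F 4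
     = (A - B) * (fps_nth W 1 * (3 * fps_nth F 3) + fps_nth W 2 * (2 * fps_nth F 2) + fps_nth W 3)"
    using e[of 3] F1 W0 by (simp add: fps_mult_nth eval_nat_numeral)
  then have "24 * fps_nth F 4 = (A - B) * (2 * fps_nth W 3 + (3 * A - 7 * B) * fps_nth W 1 * fps_nth W 2
       + (A - 2 * B) * (A - 3 * B) * fps_nth W 1 ^ 3)"
    using e2 e3 by algebra
  then show "fps_nth F 4 = (A - B) * (2 * fps_nth W 3 + (3 * A - 7 * B) * fps_nth W 1 * fps_nth W 2
       + (A - 2 * B) * (A - 3 * B) * fps_nth W 1 ^ 3) / 24"
    by (simp add: field_simps)
qed

lemma hankel_in_schwarz_coeffs:
  fixes A B c1 c2 c3 a2 a3 a4 :: complex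
  assumes "a2 = (A - B) * c1 / 2" "a3 = (A - B) * (c2 + (A - 2 * B) * c1\<^sup>2) / 6"
    "a4 = (A - B) * (2 * c3 + (3 * A - 7 * B) * c1 * c2 + (A - 2 * B) * (A - 3 * B) * c1 ^ 3) / 24"
  shows "(13 / 12 * a2 ^ 4 + a2 * a4 - a2\<^sup>2 * a3 - a3\<^sup>2) / 4 =
    (A - B)\<^sup>2 / 576 * (6 * c1 * c3 - (5 * A - B) * c1\<^sup>2 * c2
      + (11 * A\<^sup>2 - 2 * A * B - B\<^sup>2) / 4 * c1 ^ 4 - 4 * c2\<^sup>2)"
  unfolding assms by (simp add: field_simps power2_eq_square power3_eq_cube power4_eq_xxxx)

section \<open>Estimates\<close>

text \<open>After multiplication by the conjugate of the denominator the real part is affine in \<open>Re w\<close>.  At the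
  end points \<open>Re w = \<plusminus>|w|\<close> it is \<open>(1 \<plusminus> A |w|) (1 \<plusminus> B |w|)\<close>, which is positive.\<close>

lemma janowski_Re_pos:
  fixes A B :: real
  assumes "-1 \<le> B" "B \<le> 1" "-1 \<le> A" "A \<le> 1" and w: "norm w < 1"
  shows "1 + of_real B * w \<noteq> 0" "Re ((1 + of_real A * w) / (1 + of_real B * w)) > 0"
proof -
  have lt: "\<bar>c * norm w\<bar> < 1" if "-1 \<le> c" "c \<le> 1" for c :: real
  proof -
    have "\<bar>c\<bar> * norm w \<le> 1 * norm w" using that by (intro mult_right_mono) auto
    with w show ?thesis by (simp add: abs_mult)
  qed
  have lA: "\<bar>A * norm w\<bar> < 1" and lB: "\<bar>B * norm w\<bar> < 1" using lt assms by auto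
  have "norm (of_real B * w) < 1" using lB by (simp add: norm_mult abs_mult)
  then show "1 + of_real B * w \<noteq> 0"
    by (metis add_eq_0_iff less_irrefl norm_minus_cancel norm_one)
  have x: "\<bar>Re w\<bar> \<le> norm w" by (rule abs_Re_le_cmod)
  have p: "0 < (1 + A * norm w) * (1 + B * norm w)" "0 < (1 - A * norm w) * (1 - B * norm w)"
    using lA lB by (auto intro!: mult_pos_pos)
  have "0 < 1 + (A + B) * Re w + A * B * (norm w)\<^sup>2"
  proof (cases "A + B \<ge> 0")
    case True
    then have "(A + B) * - norm w \<le> (A + B) * Re w" using x by (intro mult_left_mono) auto
    with p(2) show ?thesis by (simp add: algebra_simps power2_eq_square)
  next
    case False
    then have "(A + B) * norm w \<le> (A + B) * Re w" using x by (intro mult_left_mono_neg) auto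
    with p(1) show ?thesis by (simp add: algebra_simps power2_eq_square)
  qed
  moreover have "Re ((1 + of_real A * w) * cnj (1 + of_real B * w))
      = 1 + (A + B) * Re w + A * B * (norm w)\<^sup>2"
    unfolding cmod_power2 by (simp add: algebra_simps power2_eq_square)
  ultimately show "Re ((1 + of_real A * w) / (1 + of_real B * w)) > 0"
    unfolding Re_complex_div_gt_0 by simp
qed

text \<open>After substitution of the parametrised coefficients, the triangle inequality leaves a function of
  \<open>r = |c|\<close> and \<open>y = |b|\<close>.  It is largest for \<open>y = 1\<close>, because \<open>6 r \<le> 4 + 2 r\<^sup>2\<close> for \<open>r \<le> 1\<close>.\<close>

lemma schwarz_functional_bound:
  fixes c b d :: complex and N M :: real
  assumes c: "norm c \<le> 1" and b: "norm b \<le> 1" and d: "norm d \<le> 1 - (norm b)\<^sup>2"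
    and c2: "c2 = (1 - (norm c)\<^sup>2) * b" and c3: "c3 = (1 - (norm c)\<^sup>2) * (d - cnj c * b\<^sup>2)"
    and s: "s = (norm c)\<^sup>2"
  shows "norm (6 * c * c3 - of_real N * c\<^sup>2 * c2 + of_real M * c ^ 4 - 4 * c2\<^sup>2)
    \<le> (1 - s) * (4 + 2 * s + \<bar>N\<bar> * s) + \<bar>M\<bar> * s\<^sup>2"
proof -
  define r where "r = norm c"
  define y where "y = norm b"
  have r: "0 \<le> r" "r \<le> 1" and y: "0 \<le> y" "y \<le> 1" using b c by (auto simp: r_def y_def)
  have sr: "s = r\<^sup>2" by (simp add: s r_def)
  have s01: "0 \<le> s" "s \<le> 1" using r by (auto simp: sr power_le_one)
  have y2: "y\<^sup>2 \<le> 1" using y by (auto simp: power_le_one)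
  define T where "T = 6 * c * d - of_real (4 + 2 * s) * b\<^sup>2 - of_real N * c\<^sup>2 * b"
  have cs: "c * cnj c = of_real s" unfolding s by (rule complex_norm_square[symmetric])
  have "6 * c * c3 - of_real N * c\<^sup>2 * c2 + of_real M * c ^ 4 - 4 * c2\<^sup>2
      = of_real (1 - s) * T + of_real M * c ^ 4"
    unfolding c2 c3 s[symmetric] T_def of_real_diff of_real_add of_real_mult of_real_1 of_real_numeral
      cs[symmetric] by algebra
  then have "norm (6 * c * c3 - of_real N * c\<^sup>2 * c2 + of_real M * c ^ 4 - 4 * c2\<^sup>2)
      \<le> norm (of_real (1 - s) * T) + norm (of_real M * c ^ 4)"
    by (simp only: norm_triangle_ineq)
  also have "norm (of_real (1 - s) * T) = (1 - s) * norm T"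
    using s01 by (simp only: norm_mult norm_of_real abs_of_nonneg diff_ge_0_iff_ge)
  also have "norm (of_real M * c ^ 4) = \<bar>M\<bar> * s\<^sup>2"
    by (simp add: norm_mult norm_power sr r_def)
  also have "(1 - s) * norm T \<le> (1 - s) * (4 + 2 * s + \<bar>N\<bar> * s)"
  proof (rule mult_left_mono)
    have "norm T \<le> norm (6 * c * d) + norm (of_real (4 + 2 * s) * b\<^sup>2) + norm (of_real N * c\<^sup>2 * b)"
      unfolding T_def by (rule order_trans[OF norm_triangle_ineq4 add_right_mono[OF norm_triangle_ineq4]])
    also have "norm (of_real (4 + 2 * s) * b\<^sup>2) = (4 + 2 * s) * y\<^sup>2"
      using s01 by (simp add: norm_mult norm_power y_def del: of_real_add of_real_mult of_real_numeral)
    also have "norm (of_real N * c\<^sup>2 * b) = \<bar>N\<bar> * s * y"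
      by (simp add: norm_mult norm_power s y_def)
    also have "\<bar>N\<bar> * s * y \<le> \<bar>N\<bar> * s"
      using s01 y by (intro mult_left_le) auto
    also have "norm (6 * c * d) \<le> (4 + 2 * s) * (1 - y\<^sup>2)"
    proof -
      have "0 \<le> (1 - r) * (2 - r)" using r by simp
      then have "6 * r \<le> 4 + 2 * s" by (simp add: sr algebra_simps power2_eq_square)
      then have "6 * r * norm d \<le> (4 + 2 * s) * (1 - y\<^sup>2)"
        using d s01 by (intro mult_mono) (auto simp: y_def)
      then show ?thesis by (simp add: norm_mult r_def)
    qed
    finally show "norm T \<le> 4 + 2 * s + \<bar>N\<bar> * s" by (simp add: algebra_simps)
  qed (use s01 in simp)
  finally show ?thesis by simp
qed

lemma quadratic_bound_small:
  fixes n m s :: real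
  assumes s: "0 \<le> s" "s \<le> 1" and n: "n \<le> 2" and m: "m \<le> 12"
  shows "(1 - s) * (4 + 2 * s + n * s) + m / 4 * s\<^sup>2 \<le> 4"
proof -
  have "(1 - s) * (4 + 2 * s + n * s) \<le> (1 - s) * (4 + 2 * s + 2 * s)"
    using s n by (intro mult_left_mono add_left_mono mult_right_mono) auto
  moreover have "m / 4 * s\<^sup>2 \<le> 3 * s\<^sup>2" using m by (intro mult_right_mono) auto
  moreover have "(1 - s) * (4 + 2 * s + 2 * s) + 3 * s\<^sup>2 = 4 - s\<^sup>2"
    by (simp add: algebra_simps power2_eq_square)
  moreover have "s\<^sup>2 \<ge> 0" by simp
  ultimately show ?thesis by linarith
qed

text \<open>The quadratic in \<open>s\<close> is bounded by its value at the vertex \<open>s = (n - 2) / (2 k)\<close>, where \<open>- k\<close> is its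
  leading coefficient.  For \<open>M \<ge> 0\<close> this gives a numerator \<open>36 + 12 n + n\<^sup>2\<close> in place of
  \<open>112 + 48 n + 4 n\<^sup>2\<close>, and this slack also absorbs the change of sign of \<open>M\<close> in the denominator when
  \<open>M < 0\<close>.\<close>

lemma quadratic_bound_large:
  fixes n M E s :: real
  assumes s: "0 \<le> s" "s \<le> 1" and n: "2 \<le> n" and M: "-4 \<le> M" "M \<le> 12" and E: "0 \<le> E" "E \<le> 1"
  shows "E * ((1 - s) * (4 + 2 * s + n * s) + \<bar>M\<bar> / 4 * s\<^sup>2) * (8 + 4 * n - M)
    \<le> 112 + 48 * n + 4 * n\<^sup>2 - 4 * E * M"
proof -
  define k where "k = 2 + n - \<bar>M\<bar> / 4"
  define Q where "Q = 4 + (n - 2) * s - k * s\<^sup>2"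
  have k: "k > 0" using n M by (auto simp: k_def)
  have Q: "(1 - s) * (4 + 2 * s + n * s) + \<bar>M\<bar> / 4 * s\<^sup>2 = Q"
    by (simp add: Q_def k_def algebra_simps power2_eq_square)
  \<comment> \<open>This square is \<open>16 k + (n - 2)\<^sup>2 - 4 k Q\<close>.\<close>
  have "0 \<le> (2 * k * s - (n - 2))\<^sup>2" by simp
  then have "Q * (4 * k) \<le> 16 * k + (n - 2)\<^sup>2"
    by (simp add: Q_def algebra_simps power2_eq_square)
  then have vertex: "Q * (4 * k) \<le> 36 + 12 * n + n\<^sup>2 - 4 * \<bar>M\<bar>"
    by (simp add: k_def algebra_simps power2_eq_square)
  have n2: "0 \<le> n\<^sup>2" by simp
  have En: "E * (36 + 12 * n + n\<^sup>2) \<le> 36 + 12 * n + n\<^sup>2"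
    using E n n2 by (intro mult_left_le_one_le) auto
  have Ev: "E * (Q * (4 * k)) \<le> E * (36 + 12 * n + n\<^sup>2 - 4 * \<bar>M\<bar>)"
    using vertex E by (intro mult_left_mono)
  show ?thesis
  proof (cases "M \<ge> 0")
    case True
    then have "8 + 4 * n - M = 4 * k" by (simp add: k_def)
    then have "E * Q * (8 + 4 * n - M) = E * (Q * (4 * k))" by simp
    also have "\<dots> \<le> E * (36 + 12 * n + n\<^sup>2) - 4 * E * M"
      using Ev True by (simp add: algebra_simps)
    also have "\<dots> \<le> 112 + 48 * n + 4 * n\<^sup>2 - 4 * E * M" using En n n2 by linarith
    finally show ?thesis unfolding Q .
  next
    case False
    \<comment> \<open>Here \<open>8 + 4 n - M\<close> exceeds \<open>4 k\<close> by \<open>2 |M|\<close>, and a crude bound on \<open>Q\<close> controls that excess.\<close>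
    have "(n - 2) * s \<le> n - 2" using n s by (intro mult_left_le) auto
    moreover have "0 \<le> k * s\<^sup>2" using k by simp
    ultimately have Qle: "Q \<le> n + 2" by (simp add: Q_def)
    have "E * \<bar>M\<bar> * Q \<le> E * \<bar>M\<bar> * (n + 2)" using Qle E by (intro mult_left_mono) auto
    also have "\<dots> \<le> 1 * 4 * (n + 2)" using E M n False by (intro mult_right_mono mult_mono) auto
    finally have EMQ: "E * \<bar>M\<bar> * Q \<le> 4 * (n + 2)" by simp
    have "8 + 4 * n - M = 4 * k + 2 * \<bar>M\<bar>" using False by (simp add: k_def)
    then have "E * Q * (8 + 4 * n - M) = E * (Q * (4 * k)) + 2 * (E * \<bar>M\<bar> * Q)"
      by (simp add: algebra_simps)
    also have "\<dots> \<le> E * (36 + 12 * n + n\<^sup>2) - 4 * (E * \<bar>M\<bar>) + 8 * (n + 2)"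
      using Ev EMQ by (simp add: algebra_simps)
    also have "\<dots> \<le> 112 + 48 * n + 4 * n\<^sup>2 - 4 * E * M"
    proof -
      have "X - 4 * Y + 8 * (n + 2) \<le> 112 + 48 * n + 4 * q + 4 * Y"
        if "X \<le> 36 + 12 * n + q" "0 \<le> Y" "0 \<le> q" for X Y q
        using that n by argo
      from this[OF En _ n2, of "E * \<bar>M\<bar>"] show ?thesis using E False
        by (simp add: mult_nonneg_nonpos)
    qed
    finally show ?thesis unfolding Q .
  qed
qed

text \<open>Here \<open>n = |5 A - B|\<close> and \<open>M = 12 A\<^sup>2 - (A + B)\<^sup>2\<close>, so \<open>-4 \<le> M \<le> 12\<close>, and \<open>E = (A - B)\<^sup>2 / 4 \<le> 1\<close>.
  The denominator of the first bound is negative: \<open>M - 4 n - 8 \<le> 12 - 16\<close> for \<open>n \<ge> 2\<close>.\<close>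

lemma janowski_numerical_bound:
  fixes A B s :: real
  assumes AB: "-1 \<le> B" "B < A" "A \<le> 1" and s: "0 \<le> s" "s \<le> 1"
  shows "(A - B)\<^sup>2 / 576 * ((1 - s) * (4 + 2 * s + \<bar>5 * A - B\<bar> * s)
      + \<bar>(11 * A\<^sup>2 - 2 * A * B - B\<^sup>2) / 4\<bar> * s\<^sup>2) \<le>
    (if \<bar>5 * A - B\<bar> \<ge> 2 then
                 ((A - B)^2 * (11 * A^2 - 2 * A * B - B^2) - 48 * \<bar>5 * A - B\<bar>
                    - 4 * (5 * A - B)^2 - 112)
                 / (144 * ((11 * A^2 - 2 * A * B - B^2) - 4 * \<bar>5 * A - B\<bar> - 8))
               else (A - B)^2 / 144)"
proof -
  define n where "n = \<bar>5 * A - B\<bar>"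
  define M where "M = 11 * A\<^sup>2 - 2 * A * B - B\<^sup>2"
  define E where "E = (A - B)\<^sup>2 / 4"
  define Q where "Q = (1 - s) * (4 + 2 * s + n * s) + \<bar>M\<bar> / 4 * s\<^sup>2"
  have n2: "n\<^sup>2 = (5 * A - B)\<^sup>2" by (simp add: n_def)
  have Meq: "M = 12 * A\<^sup>2 - (A + B)\<^sup>2" by (simp add: M_def power2_eq_square algebra_simps)
  have "\<bar>A\<bar> \<le> 1" "\<bar>A + B\<bar> \<le> 2" "\<bar>A - B\<bar> \<le> 2" using AB by auto
  then have "A\<^sup>2 \<le> 1" "(A + B)\<^sup>2 \<le> 4" "(A - B)\<^sup>2 \<le> 4"
    using abs_le_square_iff[of A 1] abs_le_square_iff[of "A + B" 2] abs_le_square_iff[of "A - B" 2]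
    by simp_all
  then have M: "-4 \<le> M" "M \<le> 12" and E: "0 \<le> E" "E \<le> 1"
    using zero_le_power2[of A] zero_le_power2[of "A + B"] zero_le_power2[of "A - B"]
    unfolding Meq E_def by linarith+
  have lhs: "(A - B)\<^sup>2 / 576 * ((1 - s) * (4 + 2 * s + \<bar>5 * A - B\<bar> * s)
      + \<bar>(11 * A\<^sup>2 - 2 * A * B - B\<^sup>2) / 4\<bar> * s\<^sup>2) = E * Q / 144"
    unfolding M_def[symmetric] n_def[symmetric] by (simp add: Q_def E_def abs_divide)
  show ?thesis
  proof (cases "n \<ge> 2")
    case True
    have K: "8 + 4 * n - M > 0" using True M by simp
    have "E * Q * (8 + 4 * n - M) \<le> 112 + 48 * n + 4 * n\<^sup>2 - 4 * E * M"
      unfolding Q_def by (rule quadratic_bound_large[OF s True M E])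
    then have "E * Q \<le> (112 + 48 * n + 4 * n\<^sup>2 - 4 * E * M) / (8 + 4 * n - M)"
      using K by (simp add: pos_le_divide_eq)
    then have "E * Q / 144 \<le> (112 + 48 * n + 4 * n\<^sup>2 - 4 * E * M) / (8 + 4 * n - M) / 144"
      by (rule divide_right_mono) simp
    also have "\<dots> = - (112 + 48 * n + 4 * n\<^sup>2 - 4 * E * M) / - (144 * (8 + 4 * n - M))"
      by (simp only: minus_divide_divide divide_divide_eq_left mult.commute)
    also have "\<dots> = ((A - B)\<^sup>2 * M - 48 * n - 4 * n\<^sup>2 - 112) / (144 * (M - 4 * n - 8))"
      by (rule arg_cong2[where f = "(/)"]) (simp_all add: E_def)
    finally have "E * Q / 144 \<le> ((A - B)\<^sup>2 * M - 48 * n - 4 * n\<^sup>2 - 112) / (144 * (M - 4 * n - 8))" .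
    moreover have "2 \<le> \<bar>5 * A - B\<bar>" using True unfolding n_def .
    ultimately show ?thesis unfolding lhs unfolding n2 unfolding n_def M_def by (simp only: if_True)
  next
    case False
    have "Q \<le> 4" unfolding Q_def using False M by (intro quadratic_bound_small s) auto
    then have "E * Q / 144 \<le> E * 4 / 144"
      using E by (intro divide_right_mono mult_left_mono) auto
    also have "\<dots> = (A - B)\<^sup>2 / 144" by (simp add: E_def)
    finally have "E * Q / 144 \<le> (A - B)\<^sup>2 / 144" .
    moreover have c: "\<not> 2 \<le> \<bar>5 * A - B\<bar>" using False unfolding n_def .
    ultimately show ?thesis unfolding lhs if_not_P[OF c] by simp
  qed
qed

section \<open>The Hankel determinant on the Janowski convex class\<close>

text \<open>The Hankel determinant of the logarithmic inverse coefficients is a polynomial in the first three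
  coefficients of the Schwarz function, homogeneous of degree 4 when each has its index as weight.  The starlikeness of \<open>f\<close> enters
  only to identify the germ of the chosen inverse at 0.\<close>

lemma hankel2_janowski:
  fixes A B :: real and f \<omega> :: "complex \<Rightarrow> complex"
  assumes AB: "-1 \<le> B" "B < A" "A \<le> 1"
    and f: "f holomorphic_on ball 0 1" "f 0 = 0" "deriv f 0 = 1"
    and nz: "\<forall>z\<in>ball 0 1. deriv f z \<noteq> 0"
    and \<omega>: "\<omega> holomorphic_on ball 0 1" "\<omega> ` ball 0 1 \<subseteq> ball 0 1" "\<omega> 0 = 0"
    and eq: "\<forall>z\<in>ball 0 1. 1 + z * deriv (deriv f) z / deriv f z
       = (1 + of_real A * \<omega> z) / (1 + of_real B * \<omega> z)"
    and W: "\<omega> has_fps_expansion W"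
  shows "hankel2 (log_inverse_coeff f) 1 = of_real ((A - B)\<^sup>2 / 576) *
    (6 * fps_nth W 1 * fps_nth W 3 - of_real (5 * A - B) * (fps_nth W 1)\<^sup>2 * fps_nth W 2
      + of_real ((11 * A\<^sup>2 - 2 * A * B - B\<^sup>2) / 4) * fps_nth W 1 ^ 4 - 4 * (fps_nth W 2)\<^sup>2)"
proof -
  have \<omega>1: "norm (\<omega> z) < 1" if "z \<in> ball 0 1" for z
    using \<omega>(2) that by (force simp: image_subset_iff)
  have nz': "1 + of_real B * \<omega> z \<noteq> 0"
    and pos: "Re ((1 + of_real A * \<omega> z) / (1 + of_real B * \<omega> z)) > 0"
    if "z \<in> ball 0 1" for z
    using janowski_Re_pos[of B A "\<omega> z"] AB \<omega>1[OF that] by auto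
  have star: "Re (f z / (z * deriv f z)) > 0" if "z \<in> ball 0 1" "z \<noteq> 0" for z
    using nz eq pos by (intro convex_imp_Re_quotient_pos f that) auto
  have fnz: "f z \<noteq> 0" if "z \<in> ball 0 1" "z \<noteq> 0" for z
    using star[OF that] by auto
  have mono: "norm (f (of_real t * z)) \<le> norm (f z)"
    if "z \<in> ball 0 1" "0 < t" "t \<le> 1" for z t
    by (rule starlike_norm_mono[OF f(1) star that])
  have d0: "deriv f 0 \<noteq> 0" using f(3) by simp
  obtain g where g: "g analytic_on {0}" "g 0 = 0" "\<forall>\<^sub>F w in nhds 0. f (g w) = w"
    and inv: "\<forall>\<^sub>F w in nhds 0. inv_into (ball 0 1) f w = g w"
  proof (rule inv_into_disc_germ[OF f(1,2) d0])
    show "f z \<noteq> 0" if "z \<in> ball 0 1" "z \<noteq> 0" for z by (rule fnz[OF that])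
    show "norm (f (of_real t * z)) \<le> norm (f z)"
      if "z \<in> ball 0 1" "0 < t" "t \<le> 1" for z t by (rule mono[OF that])
  qed (rule that)
  define F where "F = fps_expansion f 0"
  have F: "f has_fps_expansion F" unfolding F_def by (rule fps_expansion_disc[OF f(1)])
  note F' = has_fps_expansion_deriv[OF F]
  note F'' = has_fps_expansion_deriv[OF F']
  have F0: "fps_nth F 0 = 0"
    using has_fps_expansion_imp_0_eq_fps_nth_0[OF F] f(2) by simp
  have F1: "fps_nth F 1 = 1"
    using has_fps_expansion_imp_0_eq_fps_nth_0[OF F'] f(3) by simp
  have W0: "fps_nth W 0 = 0"
    using has_fps_expansion_imp_0_eq_fps_nth_0[OF W] \<omega>(3) by simp
  have ode: "z * deriv (deriv f) z * (1 + of_real B * \<omega> z) = of_real (A - B) * \<omega> z * deriv f z"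
    if z: "z \<in> ball 0 1" for z
  proof -
    have "(deriv f z + z * deriv (deriv f) z) * (1 + of_real B * \<omega> z)
        = (1 + of_real A * \<omega> z) * deriv f z"
      using eq z nz nz'[OF z] by (auto simp: field_simps)
    then show ?thesis by (simp add: algebra_simps)
  qed
  have "fps_X * fps_deriv (fps_deriv F) * (1 + fps_const (of_real B) * W)
      = fps_const (of_real (A - B)) * W * fps_deriv F"
    by (rule fps_expansion_unique_disc[
          where f = "\<lambda>z. z * deriv (deriv f) z * (1 + of_real B * \<omega> z)", OF _ _ ode])
       (intro fps_expansion_intros F' F'' W; simp)+
  then have "fps_X * fps_deriv (fps_deriv F) * (1 + fps_const (of_real B) * W)
      = fps_const (of_real A - of_real B) * W * fps_deriv F" by simp
  note a = janowski_fps_coeffs[OF F1 W0 this]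
  show ?thesis
    unfolding hankel2_log_inverse[OF F F0 F1 g inv] hankel_in_schwarz_coeffs[OF a] by simp
qed

text \<open>The extremal function belongs to \<open>\<omega> z = z\<^sup>2\<close>, whose only nonzero coefficient is the second, so that
  the polynomial reduces to \<open>-4\<close>.  The function is obtained by integrating
  \<open>f'' / f' = k = (A - B) z / (1 + B z\<^sup>2)\<close> twice.\<close>

lemma janowski_extremal:
  fixes A B :: real
  assumes AB: "-1 \<le> B" "B < A" "A \<le> 1"
  shows "\<exists>f \<in> janowski_convex A B. norm (hankel2 (log_inverse_coeff f) 1) = (A - B)\<^sup>2 / 144"
proof -
  have sq: "norm (z\<^sup>2) < 1" if "z \<in> ball 0 1" for z :: complex
    using that by (simp add: norm_power power_less_one_iff)
  have nz: "1 + of_real B * z\<^sup>2 \<noteq> 0" if "z \<in> ball 0 1" for z :: complex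
    using janowski_Re_pos(1)[of B A "z\<^sup>2"] AB sq[OF that] by auto
  define k where "k = (\<lambda>z::complex. of_real (A - B) * z / (1 + of_real B * z\<^sup>2))"
  have "k holomorphic_on ball 0 1"
    unfolding k_def using nz by (intro holomorphic_intros) auto
  then obtain K0 where K0: "\<And>z. z \<in> ball 0 1 \<Longrightarrow> (K0 has_field_derivative k z) (at z)"
    using holomorphic_convex_primitive'[of "ball 0 1" k] at_within_open[OF _ open_ball] by (metis convex_ball open_ball)
  define e where "e = (\<lambda>z. exp (K0 z - K0 0))"
  have de: "(e has_field_derivative e z * k z) (at z)" if "z \<in> ball 0 1" for z
    unfolding e_def by (auto intro!: derivative_eq_intros K0[OF that])
  have hole: "e holomorphic_on ball 0 1"
    unfolding holomorphic_on_open[OF open_ball] using de by blast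
  then obtain f0 where f0: "\<And>z. z \<in> ball 0 1 \<Longrightarrow> (f0 has_field_derivative e z) (at z)"
    using holomorphic_convex_primitive'[of "ball 0 1" e] at_within_open[OF _ open_ball] by (metis convex_ball open_ball)
  define f where "f = (\<lambda>z. f0 z - f0 0)"
  have df: "(f has_field_derivative e z) (at z)" if "z \<in> ball 0 1" for z
    unfolding f_def by (auto intro!: derivative_eq_intros f0[OF that])
  have holf: "f holomorphic_on ball 0 1"
    unfolding holomorphic_on_open[OF open_ball] using df by blast
  have d1: "deriv f z = e z" if "z \<in> ball 0 1" for z
    using df[OF that] by (rule DERIV_imp_deriv)
  have d2: "deriv (deriv f) z = e z * k z" if "z \<in> ball 0 1" for z
  proof (rule DERIV_imp_deriv)
    show "(deriv f has_field_derivative e z * k z) (at z)"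
      by (rule has_field_derivative_transform_within_open[OF de[OF that] open_ball that])
         (simp add: d1)
  qed
  have e: "e z \<noteq> 0" "e 0 = 1" for z by (auto simp: e_def)
  have f: "f 0 = 0" "deriv f 0 = 1" using d1[of 0] e by (auto simp: f_def)
  have nzf: "\<forall>z\<in>ball 0 1. deriv f z \<noteq> 0" using d1 e by simp
  have eq: "\<forall>z\<in>ball 0 1. 1 + z * deriv (deriv f) z / deriv f z
       = (1 + of_real A * z\<^sup>2) / (1 + of_real B * z\<^sup>2)"
  proof
    fix z :: complex assume z: "z \<in> ball 0 1"
    show "1 + z * deriv (deriv f) z / deriv f z = (1 + of_real A * z\<^sup>2) / (1 + of_real B * z\<^sup>2)"
      unfolding d1[OF z] d2[OF z]
    proof -
      have "z * (e z * k z) / e z = z * k z" using e(1)[of z] by simp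
      then show "1 + z * (e z * k z) / e z = (1 + of_real A * z\<^sup>2) / (1 + of_real B * z\<^sup>2)"
        using nz[OF z] by (simp add: k_def field_simps power2_eq_square)
    qed
  qed
  have \<omega>: "(\<lambda>z::complex. z\<^sup>2) holomorphic_on ball 0 1" "(\<lambda>z::complex. z\<^sup>2) ` ball 0 1 \<subseteq> ball 0 1"
    "(0::complex)\<^sup>2 = 0"
    using sq by (auto intro!: holomorphic_intros)
  have "deriv f holomorphic_on ball 0 1" "deriv (deriv f) holomorphic_on ball 0 1"
    using holf by (auto intro!: holomorphic_deriv)
  then have "(\<lambda>z. 1 + z * deriv (deriv f) z / deriv f z) holomorphic_on ball 0 1"
    using nzf by (intro holomorphic_on_add holomorphic_on_divide holomorphic_on_mult
        holomorphic_on_const holomorphic_on_ident) auto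
  moreover have "1 + of_real B * z \<noteq> 0" if "z \<in> ball 0 1" for z :: complex
    using janowski_Re_pos(1)[of B A z] AB that by auto
  then have "(\<lambda>z::complex. (1 + of_real A * z) / (1 + of_real B * z)) holomorphic_on ball 0 1"
    by (intro holomorphic_intros) auto
  ultimately have "subordinate (\<lambda>z. 1 + z * deriv (deriv f) z / deriv f z)
      (\<lambda>z::complex. (1 + of_real A * z) / (1 + of_real B * z))"
    unfolding subordinate_def using \<omega> eq by (intro conjI exI[of _ "\<lambda>z. z\<^sup>2"]) auto
  then have mem: "f \<in> janowski_convex A B"
    using holf f nzf by (simp add: janowski_convex_def normalized_holomorphic_def)
  have W: "(\<lambda>z::complex. z\<^sup>2) has_fps_expansion fps_X ^ 2"
    by (rule has_fps_expansion_fps_X_power)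
  have "hankel2 (log_inverse_coeff f) 1 = of_real ((A - B)\<^sup>2 / 576) * (- 4)"
    unfolding hankel2_janowski[OF AB holf f nzf \<omega> eq W] by (simp add: fps_X_power_nth)
  then have "norm (hankel2 (log_inverse_coeff f) 1) = (A - B)\<^sup>2 / 144"
    by (simp add: norm_mult norm_divide norm_power flip: of_real_diff)
  with mem show ?thesis by blast
qed

theorem theorem5p1:
  fixes A B :: real
  assumes "-1 \<le> B" and "B < A" and "A \<le> 1"
  shows "(\<forall>f \<in> janowski_convex A B.
            norm (hankel2 (log_inverse_coeff f) 1) \<le>
              (if \<bar>5 * A - B\<bar> \<ge> 2 then
                 ((A - B)^2 * (11 * A^2 - 2 * A * B - B^2) - 48 * \<bar>5 * A - B\<bar>
                    - 4 * (5 * A - B)^2 - 112)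
                 / (144 * ((11 * A^2 - 2 * A * B - B^2) - 4 * \<bar>5 * A - B\<bar> - 8))
               else (A - B)^2 / 144))
         \<and> (\<bar>5 * A - B\<bar> < 2 \<longrightarrow>
              (\<exists>f \<in> janowski_convex A B.
                 norm (hankel2 (log_inverse_coeff f) 1) = (A - B)^2 / 144))"
proof (intro conjI impI ballI)
  show "\<exists>f \<in> janowski_convex A B. norm (hankel2 (log_inverse_coeff f) 1) = (A - B)^2 / 144"
    by (rule janowski_extremal[OF assms])
next
  fix f assume "f \<in> janowski_convex A B"
  then obtain \<omega> where f: "f holomorphic_on ball 0 1" "f 0 = 0" "deriv f 0 = 1"
      "\<forall>z\<in>ball 0 1. deriv f z \<noteq> 0"
    and \<omega>: "\<omega> holomorphic_on ball 0 1" "\<omega> ` ball 0 1 \<subseteq> ball 0 1" "\<omega> 0 = 0"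
    and eq: "\<forall>z\<in>ball 0 1. 1 + z * deriv (deriv f) z / deriv f z
       = (1 + of_real A * \<omega> z) / (1 + of_real B * \<omega> z)"
    by (auto simp: janowski_convex_def normalized_holomorphic_def subordinate_def)
  define W where "W = fps_expansion \<omega> 0"
  have W: "\<omega> has_fps_expansion W" unfolding W_def by (rule fps_expansion_disc[OF \<omega>(1)])
  define s where "s = (norm (fps_nth W 1))\<^sup>2"
  obtain b d :: complex where bd: "norm (fps_nth W 1) \<le> 1" "norm b \<le> 1" "norm d \<le> 1 - (norm b)\<^sup>2"
    "fps_nth W 2 = (1 - (norm (fps_nth W 1))\<^sup>2) * b"
    "fps_nth W 3 = (1 - (norm (fps_nth W 1))\<^sup>2) * (d - cnj (fps_nth W 1) * b\<^sup>2)"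
    using schwarz_function_coeffs[OF \<omega>(1,3,2) W] by metis
  have s: "0 \<le> s" "s \<le> 1" using bd(1) by (auto simp: s_def power_le_one)
  let ?T = "6 * fps_nth W 1 * fps_nth W 3 - of_real (5 * A - B) * (fps_nth W 1)\<^sup>2 * fps_nth W 2
      + of_real ((11 * A\<^sup>2 - 2 * A * B - B\<^sup>2) / 4) * fps_nth W 1 ^ 4 - 4 * (fps_nth W 2)\<^sup>2"
  have "norm (hankel2 (log_inverse_coeff f) 1) = (A - B)\<^sup>2 / 576 * norm ?T"
    unfolding hankel2_janowski[OF assms f \<omega> eq W] norm_mult[of "of_real _"] norm_of_real by simp
  also have "\<dots> \<le> (A - B)\<^sup>2 / 576 * ((1 - s) * (4 + 2 * s + \<bar>5 * A - B\<bar> * s)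
      + \<bar>(11 * A\<^sup>2 - 2 * A * B - B\<^sup>2) / 4\<bar> * s\<^sup>2)"
    by (intro mult_left_mono schwarz_functional_bound[OF bd s_def]) simp
  also note janowski_numerical_bound[OF assms s]
  finally show "norm (hankel2 (log_inverse_coeff f) 1) \<le>
              (if \<bar>5 * A - B\<bar> \<ge> 2 then
                 ((A - B)^2 * (11 * A^2 - 2 * A * B - B^2) - 48 * \<bar>5 * A - B\<bar>
                    - 4 * (5 * A - B)^2 - 112)
                 / (144 * ((11 * A^2 - 2 * A * B - B^2) - 4 * \<bar>5 * A - B\<bar> - 8))
               else (A - B)^2 / 144)" .
qed

end
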